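(* Assume $x(0)=x'(0)=0$. The following are equivalent: (C) $y_1(t)\to0$ as $t\to\infty$, and \[ \int_0^t\cos(\omega s)A(s)y_1(s)\,ds=o(A(t)),\qquad \int_0^t\sin(\omega s)A(s)y_1(s)\,ds=o(A(t))\quad (t\to\infty); \] (D) $x(t)\to0$ and $x'(t)\to0$ as $t\to\infty$.
   Context: Standing assumptions: $\omega>0$ is a constant; $p\in C^1([0,\infty))$ with $p(t)>0$ and $p'(t)<0$ for all $t\ge0$, $\int_0^\infty p(t)\,dt=\infty$ and $\int_0^\infty p(t)^2\,dt<\infty$; $f\in L^1_{\mathrm{loc}}([0,\infty))$. $x$ denotes the solution of $x''(t)+p(t)x'(t)+\omega^2x(t)=f(t)$, $t\ge0$. Notation: $A(t)=\exp(\frac12\int_0^tp(s)\,ds)$ (so $A(t)\to\infty$); $y_1(t)=\int_0^te^{-\omega^2(t-s)}f(s)\,ds$. *)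

theory Defs
  imports "HOL-Analysis.Analysis" "HOL-Library.Landau_Symbols"
begin

definition damp_A :: "(real \<Rightarrow> real) \<Rightarrow> real \<Rightarrow> real" where
  "damp_A p t = exp ((1/2) * (LINT s:{0..t}|lborel. p s))"

definition y1_fun :: "real \<Rightarrow> (real \<Rightarrow> real) \<Rightarrow> real \<Rightarrow> real" where
  "y1_fun \<omega> f t = (LINT s:{0..t}|lborel. exp (- (\<omega>\<^sup>2) * (t - s)) * f s)"

end

(* Put y = y1 and z = x' - y. Since y' = f - omega^2 y (in integrated form), z solves an equation
   whose right-hand side is continuous: x' = z + y, z' = - omega^2 x - p z + (omega^2 - p) y.
   In the rotating frame V = A exp(-i omega t) (z + i omega x) this reads
     V' = (omega^2 + i omega - p) A y exp(-i omega t) - (p/2) exp(-2 i omega t) cnj V.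
   The last term oscillates; integrating it by parts leaves an error controlled by p |V| and by the
   integral of (p^2 - p') |V|, where p^2 - p' is integrable. As p A = 2 A', the part -p A y integrates
   to o(A) when y tends to 0. So V = (omega^2 + i omega) J + o(A) with J the integral of
   A y exp(-i omega s), as soon as V = O(A): this is clear if x, z tend to 0, and follows from
   Gronwall's inequality for |V| / A if J = o(A). Conversely x, x' -> 0 forces y -> 0, because
   z' = - omega^2 z + o(1). *)

theory Submission
  imports Defs
begin

section \<open>Integrals on half-lines that are small relative to a growing function\<close>

lemma at_within_atLeast_eq:
  fixes t :: real
  assumes "t \<ge> a" "t < b"
  shows "at t within {a..} = at t within {a..b}"
  using assms by (intro at_within_nhd[of t "{..<b}"]) auto

lemma integral_has_vector_derivative_atLeast:
  fixes g :: "real \<Rightarrow> 'a::banach"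
  assumes "continuous_on {a..} g" "t \<ge> a"
  shows "((\<lambda>u. integral {a..u} g) has_vector_derivative g t) (at t within {a..})"
proof -
  have "continuous_on {a..t+1} g"
    using assms(1) by (rule continuous_on_subset) auto
  from integral_has_vector_derivative[OF this, of t] show ?thesis
    using assms(2) by (subst at_within_atLeast_eq[of a t "t+1"]) auto
qed

lemma integral_has_real_derivative_atLeast:
  fixes g :: "real \<Rightarrow> real"
  assumes "continuous_on {a..} g" "t \<ge> a"
  shows "((\<lambda>u. integral {a..u} g) has_real_derivative g t) (at t within {a..})"
  using integral_has_vector_derivative_atLeast[OF assms]
  by (simp add: has_real_derivative_iff_has_vector_derivative)

lemma DERIV_atLeast_imp_continuous_on:
  fixes f :: "real \<Rightarrow> real"
  assumes "\<And>t. t \<ge> a \<Longrightarrow> (f has_real_derivative f' t) (at t within {a..})"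
  shows "continuous_on {a..} f"
  using assms by (intro DERIV_continuous_on) auto

lemma integral_eq_diff_atLeast:
  fixes F :: "real \<Rightarrow> 'a::banach"
  assumes "\<And>t. t \<ge> a \<Longrightarrow> (F has_vector_derivative F' t) (at t within {a..})" "a \<le> s" "s \<le> t"
  shows "integral {s..t} F' = F t - F s"
proof (rule integral_unique, rule fundamental_theorem_of_calculus)
  show "(F has_vector_derivative F' u) (at u within {s..t})" if "u \<in> {s..t}" for u
    using has_vector_derivative_within_subset[OF assms(1)[of u], of "{s..t}"] that assms(2) by auto
qed fact

lemma LINT_eq_integral_continuous:
  fixes g :: "real \<Rightarrow> real"
  assumes "continuous_on {0..} g"
  shows "(LINT s:{0..t}|lborel. g s) = integral {0..t} g"
  by (intro set_borel_integral_eq_integral borel_integrable_atLeastAtMost'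
      continuous_on_subset[OF assms]) auto

lemma integrable_on_atLeastAtMost_if_continuous_on_atLeast:
  fixes g :: "real \<Rightarrow> 'a::banach"
  assumes "continuous_on {c..} g" "c \<le> a"
  shows "g integrable_on {a..b}"
  using assms(2) by (intro integrable_continuous_real continuous_on_subset[OF assms(1)]) auto

text \<open>The head of the integral, up to \<open>S\<close>, is a constant and hence negligible
  because \<open>B\<close> tends to infinity. Little-o is thereby reduced to a bound on the tail,
  with \<open>S\<close> allowed to depend on \<open>c\<close>.\<close>

lemma integral_smallo:
  fixes B k :: "real \<Rightarrow> real"
  assumes B: "filterlim B at_top at_top"
    and k: "continuous_on {0..} k" "\<And>t. t \<ge> 0 \<Longrightarrow> k t \<ge> 0"
    and tail: "\<And>c. c > 0 \<Longrightarrow> \<exists>S\<ge>0. \<forall>t\<ge>S. integral {S..t} k \<le> c * B t"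
  shows "(\<lambda>t. integral {0..t} k) \<in> o[at_top](B)"
proof (rule landau_o.smallI)
  fix c :: real assume "c > 0"
  then obtain S where S: "S \<ge> 0" "\<And>t. t \<ge> S \<Longrightarrow> integral {S..t} k \<le> c / 2 * B t"
    using tail[of "c/2"] by auto
  note kint = integrable_on_atLeastAtMost_if_continuous_on_atLeast[OF k(1)]
  \<comment> \<open>The second entry of the maximum makes the head at most
    \<open>c / 2 * B t\<close>; the entry 0 gives \<open>norm (B t) = B t\<close>.\<close>
  have "eventually (\<lambda>t. B t \<ge> max 0 (integral {0..S} k / (c / 2))) at_top"
    using B unfolding filterlim_at_top by blast
  then show "eventually (\<lambda>t. norm (integral {0..t} k) \<le> c * norm (B t)) at_top"
    using eventually_ge_at_top[of S]
  proof eventually_elim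
    case (elim t)
    have "integral {0..t} k = integral {0..S} k + integral {S..t} k"
      using elim S kint by (subst Henstock_Kurzweil_Integration.integral_combine) auto
    also have "\<dots> \<le> c / 2 * B t + c / 2 * B t"
      using elim S(2)[of t] \<open>c > 0\<close> by (intro add_mono) (auto simp: field_simps)
    finally have "integral {0..t} k \<le> c * B t" by simp
    moreover have "integral {0..t} k \<ge> 0"
      using k(2) kint by (intro integral_nonneg) auto
    ultimately show ?case using elim by simp
  qed
qed

text \<open>An averaging principle: once \<psi> < c, the tail is at most c times the integral of
  \<open>B'\<close>, which telescopes to \<open>B t - B S\<close>. It serves both for
  \<open>A\<close> and for an exponential weight.\<close>

lemma integral_deriv_mult_smallo:
  fixes B B' \<psi> :: "real \<Rightarrow> real"
  assumes B: "filterlim B at_top at_top"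
    and B_deriv: "\<And>t. t \<ge> 0 \<Longrightarrow> (B has_real_derivative B' t) (at t within {0..})"
    and B': "continuous_on {0..} B'" "\<And>t. t \<ge> 0 \<Longrightarrow> B' t \<ge> 0"
    and B_nonneg: "\<And>t. t \<ge> 0 \<Longrightarrow> B t \<ge> 0"
    and psi: "continuous_on {0..} \<psi>" "\<And>t. t \<ge> 0 \<Longrightarrow> \<psi> t \<ge> 0" "(\<psi> \<longlongrightarrow> 0) at_top"
  shows "(\<lambda>t. integral {0..t} (\<lambda>s. B' s * \<psi> s)) \<in> o[at_top](B)"
proof (rule integral_smallo[OF B])
  fix c :: real assume "c > 0"
  then have "eventually (\<lambda>t. \<psi> t < c) at_top"
    using psi(3) by (intro order_tendstoD)
  then obtain S0 where S0: "\<And>t. t \<ge> S0 \<Longrightarrow> \<psi> t < c"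
    by (auto simp: eventually_at_top_linorder)
  define S where "S = max 0 S0"
  have "integral {S..t} (\<lambda>s. B' s * \<psi> s) \<le> c * B t" if "t \<ge> S" for t
  proof -
    have "integral {S..t} (\<lambda>s. B' s * \<psi> s) \<le> integral {S..t} (\<lambda>s. c * B' s)"
    proof (rule integral_le)
      show "B' s * \<psi> s \<le> c * B' s" if "s \<in> {S..t}" for s
        using S0[of s] that B'(2)[of s] by (auto simp: S_def mult.commute[of c] intro!: mult_left_mono)
      show "(\<lambda>s. B' s * \<psi> s) integrable_on {S..t}" "(\<lambda>s. c * B' s) integrable_on {S..t}"
        by (rule integrable_on_atLeastAtMost_if_continuous_on_atLeast[of 0]; auto intro!: continuous_intros B' psi simp: S_def)+
    qed
    also have "\<dots> = c * (B t - B S)"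
      using integral_eq_diff_atLeast[of 0 B B' S t] B_deriv that
      by (simp add: S_def has_real_derivative_iff_has_vector_derivative)
    also have "\<dots> \<le> c * B t"
      using \<open>c > 0\<close> B_nonneg[of S] by (simp add: S_def)
    finally show ?thesis .
  qed
  then show "\<exists>S\<ge>0. \<forall>t\<ge>S. integral {S..t} (\<lambda>s. B' s * \<psi> s) \<le> c * B t"
    by (intro exI[of _ S]) (auto simp: S_def)
qed (use assms in \<open>auto intro!: continuous_intros\<close>)

text \<open>Since \<open>B\<close> is monotone, \<open>u\<close> is at most \<open>M * B t\<close>
  on the whole of [S,t] and can be pulled out. What remains is a tail of the convergent integral of
  \<open>g\<close>.\<close>

lemma integral_mult_bigo_smallo:
  fixes B g u :: "real \<Rightarrow> real"
  assumes B: "filterlim B at_top at_top"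
    and B_mono: "mono_on {0..} B"
    and B_pos: "\<And>t. t \<ge> 0 \<Longrightarrow> B t > 0"
    and g: "continuous_on {0..} g" "\<And>t. t \<ge> 0 \<Longrightarrow> g t \<ge> 0"
    and g_bound: "\<And>t. t \<ge> 0 \<Longrightarrow> integral {0..t} g \<le> K"
    and u: "continuous_on {0..} u" "\<And>t. t \<ge> 0 \<Longrightarrow> u t \<ge> 0" "\<And>t. t \<ge> 0 \<Longrightarrow> u t \<le> M * B t"
  shows "(\<lambda>t. integral {0..t} (\<lambda>s. g s * u s)) \<in> o[at_top](B)"
proof (rule integral_smallo[OF B])
  fix c :: real assume "c > 0"
  have "M * B 0 \<ge> 0" using u(2,3)[of 0] by simp
  then have "M \<ge> 0" using B_pos[of 0] by (simp add: zero_le_mult_iff)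
  \<comment> \<open>\<open>L\<close> is the total mass of \<open>g\<close>. Once the mass up to
    \<open>S\<close> exceeds \<open>L - c / (M + 1)\<close>, every later piece has mass below
    \<open>c / (M + 1)\<close>. The denominator \<open>M + 1\<close> covers the case
    \<open>M = 0\<close>.\<close>
  define L where "L = (SUP t\<in>{0..}. integral {0..t} g)"
  have bdd: "bdd_above ((\<lambda>t. integral {0..t} g) ` {0..})"
    using g_bound by (auto intro!: bdd_aboveI[of _ K])
  have "\<exists>S\<ge>0. L - c / (M + 1) < integral {0..S} g"
    using less_cSUP_iff[OF _ bdd, of "L - c / (M + 1)"] \<open>M \<ge> 0\<close> \<open>c > 0\<close> by (auto simp: L_def)
  then obtain S where S: "S \<ge> 0" "L - c / (M + 1) < integral {0..S} g" by blast
  note gint = integrable_on_atLeastAtMost_if_continuous_on_atLeast[OF g(1)]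
  have "integral {S..t} (\<lambda>s. g s * u s) \<le> c * B t" if "t \<ge> S" for t
  proof -
    have "integral {S..t} (\<lambda>s. g s * u s) \<le> integral {S..t} (\<lambda>s. (M * B t) * g s)"
    proof (rule integral_le)
      show "g s * u s \<le> M * B t * g s" if s: "s \<in> {S..t}" for s
      proof -
        have "M * B s \<le> M * B t"
          using s S(1) \<open>M \<ge> 0\<close> by (intro mult_left_mono mono_onD[OF B_mono]) auto
        then show ?thesis
          using u(3)[of s] s S(1) g(2)[of s] by (subst mult.commute) (intro mult_right_mono, auto)
      qed
      show "(\<lambda>s. g s * u s) integrable_on {S..t}" "(\<lambda>s. M * B t * g s) integrable_on {S..t}"
        by (rule integrable_on_atLeastAtMost_if_continuous_on_atLeast[of 0]; use S in \<open>auto intro!: continuous_intros g u\<close>)+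
    qed
    also have "\<dots> = M * B t * integral {S..t} g" by simp
    also have "\<dots> \<le> (M + 1) * B t * (c / (M + 1))"
    proof (intro mult_mono)
      have "integral {0..S} g + integral {S..t} g = integral {0..t} g"
        using that S gint by (subst Henstock_Kurzweil_Integration.integral_combine) auto
      also have "\<dots> \<le> L" unfolding L_def using that S by (intro cSUP_upper bdd) auto
      finally show "integral {S..t} g \<le> c / (M + 1)" using S by linarith
      show "0 \<le> integral {S..t} g" using g S gint by (intro integral_nonneg) auto
    qed (use \<open>M \<ge> 0\<close> B_pos[of t] that S in auto)
    also have "\<dots> = c * B t" using \<open>M \<ge> 0\<close> by (simp add: field_simps)
    finally show ?thesis .
  qed
  with S show "\<exists>S\<ge>0. \<forall>t\<ge>S. integral {S..t} (\<lambda>s. g s * u s) \<le> c * B t" by blast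
qed (use assms in \<open>auto intro!: continuous_intros\<close>)

text \<open>The right-hand side \<Phi> of the integral inequality satisfies \<Phi>' = C g r \<le> C
  g \<Phi>, so \<Phi> exp(-C G) is nonincreasing, where \<open>G\<close> is the primitive of
  \<open>g\<close>.\<close>

lemma gronwall_integral:
  fixes g r :: "real \<Rightarrow> real"
  assumes g: "continuous_on {0..} g" "\<And>t. t \<ge> 0 \<Longrightarrow> g t \<ge> 0"
    and r: "continuous_on {0..} r"
    and le: "\<And>t. t \<ge> 0 \<Longrightarrow> r t \<le> K + C * integral {0..t} (\<lambda>s. g s * r s)"
    and C: "C \<ge> 0" and t: "t \<ge> 0"
  shows "r t \<le> K * exp (C * integral {0..t} g)"
proof -
  define \<Phi> where "\<Phi> = (\<lambda>t. K + C * integral {0..t} (\<lambda>s. g s * r s))"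
  define G where "G = (\<lambda>t. integral {0..t} g)"
  have G: "(G has_real_derivative g s) (at s within {0..})" if "s \<ge> 0" for s
    unfolding G_def using that by (intro integral_has_real_derivative_atLeast g)
  have Phi: "(\<Phi> has_real_derivative C * (g s * r s)) (at s within {0..})" if "s \<ge> 0" for s
    unfolding \<Phi>_def using that
    by (auto intro!: derivative_eq_intros integral_has_real_derivative_atLeast continuous_intros g r)
  define \<Psi> where "\<Psi> = (\<lambda>s. \<Phi> s * exp (- C * G s))"
  have "\<Psi> t \<le> \<Psi> 0"
  proof (rule DERIV_nonpos_imp_decreasing_open[OF t])
    fix s assume s: "0 < s" "s < t"
    have at: "at s within {0..} = at s" using s by (intro at_within_interior) auto
    have "(\<Psi> has_real_derivative C * g s * (r s - \<Phi> s) * exp (- C * G s)) (at s within {0..})"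
      unfolding \<Psi>_def
      by (rule derivative_eq_intros Phi G | use s in \<open>force simp: algebra_simps\<close>)+
    moreover have "r s - \<Phi> s \<le> 0" using le[of s] s by (simp add: \<Phi>_def)
    then have "C * g s * (r s - \<Phi> s) * exp (- C * G s) \<le> 0"
      using C g(2)[of s] s by (intro mult_nonpos_nonneg mult_nonneg_nonpos) auto
    ultimately show "\<exists>y. (\<Psi> has_real_derivative y) (at s) \<and> y \<le> 0" unfolding at by blast
  next
    have "continuous_on {0..} \<Psi>" unfolding \<Psi>_def
      by (intro continuous_intros DERIV_atLeast_imp_continuous_on[OF Phi]
          DERIV_atLeast_imp_continuous_on[OF G])
    then show "continuous_on {0..t} \<Psi>" by (rule continuous_on_subset) auto
  qed
  then have "\<Phi> t \<le> K * exp (C * G t)"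
    by (simp add: \<Psi>_def \<Phi>_def G_def exp_minus field_simps)
  with le[OF t] show ?thesis by (simp add: \<Phi>_def G_def)
qed

section \<open>The smoothed forcing term\<close>

text \<open>A continuous factor is bounded on a compact interval, so a multiple of \<open>f\<close>
  dominates the product.\<close>

lemma set_integrable_continuous_mult:
  fixes f g :: "real \<Rightarrow> real"
  assumes g: "continuous_on UNIV g" and f: "set_integrable lborel {a..b} f"
  shows "set_integrable lborel {a..b} (\<lambda>s. g s * f s)"
proof -
  have "compact (g ` {a..b})"
    by (intro compact_continuous_image continuous_on_subset[OF g]) auto
  then obtain M where M: "\<And>s. s \<in> {a..b} \<Longrightarrow> \<bar>g s\<bar> \<le> M"
    by (metis bounded_iff compact_imp_bounded image_eqI real_norm_def)
  have [measurable]: "g \<in> borel_measurable borel" 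
    using g by (rule borel_measurable_continuous_onI)
  have fi: "integrable lborel (\<lambda>s. indicator {a..b} s * f s)"
    using f by (simp add: set_integrable_def)
  note [measurable] = borel_measurable_integrable[OF this]
  have "integrable lborel (\<lambda>s. g s * (indicator {a..b} s * f s))"
  proof (rule Bochner_Integration.integrable_bound)
    show "integrable lborel (\<lambda>s. M * (indicator {a..b} s * f s))"
      using fi by simp
    have "\<bar>g s * (indicator {a..b} s * f s)\<bar> \<le> \<bar>M * (indicator {a..b} s * f s)\<bar>" for s
      using M[of s] by (cases "s \<in> {a..b}") (auto simp: abs_mult intro!: mult_right_mono)
    then show "AE s in lborel. norm (g s * (indicator {a..b} s * f s))
        \<le> norm (M * (indicator {a..b} s * f s))" by simp
  qed measurable
  then show ?thesis by (simp add: set_integrable_def mult.left_commute)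
qed

text \<open>Splitting the exponential kernel leaves an integrand free of \<open>t\<close>, so that
  continuity in \<open>t\<close> follows from continuity of an indefinite integral.\<close>

lemma y1_fun_eq: "y1_fun \<omega> f t = exp (- \<omega>\<^sup>2 * t) * (LINT s:{0..t}|lborel. exp (\<omega>\<^sup>2 * s) * f s)"
proof -
  have "exp (- \<omega>\<^sup>2 * (t - s)) * f s = exp (- \<omega>\<^sup>2 * t) * (exp (\<omega>\<^sup>2 * s) * f s)" for s
    by (simp add: algebra_simps flip: exp_add)
  then show ?thesis unfolding y1_fun_def by (simp only: set_integral_mult_right)
qed

lemma continuous_on_y1_fun:
  assumes f: "\<And>t. t \<ge> 0 \<Longrightarrow> set_integrable lborel {0..t} f"
  shows "continuous_on {0..} (y1_fun \<omega> f)"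
proof -
  define h where "h = (\<lambda>s. exp (\<omega>\<^sup>2 * s) * f s)"
  have h: "set_integrable lborel {0..t} h" for t
  proof (cases "t \<ge> 0")
    case True
    then show ?thesis unfolding h_def
      by (intro set_integrable_continuous_mult f continuous_intros)
  qed (simp add: set_integrable_def)
  have eq: "y1_fun \<omega> f t = exp (- \<omega>\<^sup>2 * t) * integral {0..t} h" for t
    using set_borel_integral_eq_integral(2)[OF h] by (simp add: y1_fun_eq h_def)
  have "continuous (at t within {0..}) (y1_fun \<omega> f)" if t: "t \<ge> 0" for t
  proof -
    have "continuous_on {0..t+1} (y1_fun \<omega> f)" unfolding eq
      using set_borel_integral_eq_integral(1)[OF h]
      by (intro continuous_intros indefinite_integral_continuous_1)
    then show ?thesis
      using t by (subst at_within_atLeast_eq[of 0 t "t+1"]) (auto simp: continuous_on_eq_continuous_within)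
  qed
  then show ?thesis by (simp add: continuous_on_eq_continuous_within)
qed

text \<open>The integrated form of y' = f - omega^2 y. As \<open>f\<close> is merely integrable, it
  is obtained by Fubini on the triangle 0 \<le> s \<le> r \<le> t: integrating the kernel omega^2
  exp(-omega^2 (r - s)) over \<open>r\<close> first gives 1 - exp(-omega^2 (t - s)).\<close>

lemma y1_fun_integral_equation:
  fixes f :: "real \<Rightarrow> real"
  assumes f: "set_integrable lborel {0..t} f" and t: "t \<ge> 0"
  shows "\<omega>\<^sup>2 * (LINT r:{0..t}|lborel. y1_fun \<omega> f r) = (LINT s:{0..t}|lborel. f s) - y1_fun \<omega> f t"
proof -
  define F where "F = (\<lambda>s. indicator {0..t} s * f s)"
  have F: "integrable lborel F" using f by (simp add: set_integrable_def F_def)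
  note [measurable] = borel_measurable_integrable[OF F]
  define h where "h = (\<lambda>s r. indicator {s..t} r * (\<omega>\<^sup>2 * exp (- \<omega>\<^sup>2 * (r - s))) * F s)"
  \<comment> \<open>Written with the indicator of a set of pairs, \<open>h\<close> is visibly
    jointly measurable.\<close>
  have h_eq: "h s r = indicator {q. fst q \<le> snd q \<and> snd q \<le> t} (s, r) * (\<omega>\<^sup>2 * exp (- \<omega>\<^sup>2 * (r - s))) * F s"
    for s r unfolding h_def by (auto simp: indicator_def)
  have h_meas [measurable]: "case_prod h \<in> borel_measurable (lborel \<Otimes>\<^sub>M lborel)"
    unfolding h_eq case_prod_unfold prod.collapse by measurable
  have "integrable lborel (indicat_real {0..t})"
    by (intro integrable_real_indicator) (auto simp: emeasure_lborel_Icc_eq)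
  \<comment> \<open>The dominating function: on the triangle the exponential is at most 1, so
    \<open>h\<close> is bounded by a product of integrable functions of one variable each.\<close>
  then have "integrable (lborel \<Otimes>\<^sub>M lborel) (\<lambda>(s, r). F s * (\<omega>\<^sup>2 * indicator {0..t} r))"
    using F by (intro lborel_pair.Fubini_integrable) (auto simp: abs_mult case_prod_unfold)
  then have int: "integrable (lborel \<Otimes>\<^sub>M lborel) (case_prod h)"
  proof (rule Bochner_Integration.integrable_bound)
    have "\<bar>h s r\<bar> \<le> \<bar>F s * (\<omega>\<^sup>2 * indicator {0..t} r)\<bar>" for s r
    proof (cases "s \<le> r")
      case True
      have "exp (- (\<omega>\<^sup>2 * (r - s))) \<le> 1" using True by simp
      then show ?thesis
        using True by (auto simp: h_def F_def indicator_def abs_mult mult.commute[of _ "\<bar>f s\<bar>"]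
          intro!: mult_left_mono mult_left_le)
    qed (auto simp: h_def)
    then show "AE q in lborel \<Otimes>\<^sub>M lborel. norm (case q of (s, r) \<Rightarrow> h s r)
        \<le> norm (case q of (s, r) \<Rightarrow> F s * (\<omega>\<^sup>2 * indicator {0..t} r))" by (simp add: case_prod_unfold)
  qed measurable
  have inner_s: "(LINT s|lborel. h s r) = \<omega>\<^sup>2 * (indicator {0..t} r * y1_fun \<omega> f r)" for r
  proof -
    have "(LINT s|lborel. h s r) = (LINT s|lborel. (\<omega>\<^sup>2 * indicator {0..t} r) *
        (indicator {0..r} s * (exp (- \<omega>\<^sup>2 * (r - s)) * f s)))"
      by (intro Bochner_Integration.integral_cong) (auto simp: h_def F_def indicator_def)
    then show ?thesis by (simp add: y1_fun_def set_lebesgue_integral_def)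
  qed
  have inner_r: "(LINT r|lborel. h s r) = (1 - exp (- \<omega>\<^sup>2 * (t - s))) * F s" for s
  proof (cases "s \<in> {0..t}")
    case True
    have "(LINT r|lborel. (\<omega>\<^sup>2 * exp (- \<omega>\<^sup>2 * (r - s))) * indicator {s..t} r)
        = - exp (- \<omega>\<^sup>2 * (t - s)) - (- exp (- \<omega>\<^sup>2 * (s - s)))"
      using True by (intro integral_FTC_Icc_real)
        (auto intro!: derivative_eq_intros continuous_intros)
    then show ?thesis unfolding h_def by (simp add: mult.commute mult.left_commute)
  qed (simp add: h_def F_def)
  have "\<omega>\<^sup>2 * (LINT r:{0..t}|lborel. y1_fun \<omega> f r) = (LINT r|lborel. LINT s|lborel. h s r)"
    by (simp add: inner_s set_lebesgue_integral_def)
  also have "\<dots> = (LINT s|lborel. LINT r|lborel. h s r)"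
    using int by (intro lborel_pair.Fubini_integral)
  also have "\<dots> = (LINT s:{0..t}|lborel. f s - exp (- \<omega>\<^sup>2 * (t - s)) * f s)"
    by (simp add: inner_r set_lebesgue_integral_def F_def algebra_simps)
  also have "\<dots> = (LINT s:{0..t}|lborel. f s) - y1_fun \<omega> f t"
    unfolding y1_fun_def
    by (intro set_integral_diff f set_integrable_continuous_mult continuous_intros)
  finally show ?thesis .
qed

text \<open>Being a derivative, \<open>F'\<close> is gauge integrable with integral
  \<open>F t - F a\<close>, so a pointwise bound on its norm can be integrated.\<close>

lemma norm_diff_le_integral_atLeast:
  fixes F :: "real \<Rightarrow> 'a::banach"
  assumes F: "\<And>t. t \<ge> a \<Longrightarrow> (F has_vector_derivative F' t) (at t within {a..})"
    and g: "continuous_on {a..} g" and bound: "\<And>t. t \<ge> a \<Longrightarrow> norm (F' t) \<le> g t" and t: "a \<le> t"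
  shows "norm (F t - F a) \<le> integral {a..t} g"
proof -
  have "(F' has_integral (F t - F a)) {a..t}"
  proof (rule fundamental_theorem_of_calculus[OF t])
    show "(F has_vector_derivative F' u) (at u within {a..t})" if "u \<in> {a..t}" for u
      using that by (intro has_vector_derivative_within_subset[OF F]) auto
  qed
  moreover from this have "norm (integral {a..t} F') \<le> integral {a..t} g"
    using bound
    by (intro Henstock_Kurzweil_Integration.integral_norm_bound_integral
        integrable_on_atLeastAtMost_if_continuous_on_atLeast[OF g]) auto
  ultimately show ?thesis by (simp add: integral_unique)
qed

section \<open>The oscillator in the rotating frame\<close>

text \<open>The forcing enters only through the continuous function \<open>y\<close>, and
  \<open>z\<close> stands for x' - y. The system for \<open>x\<close> and \<open>z\<close> has a
  continuous right-hand side, so both are differentiable in the classical sense. \<open>A\<close> is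
  specified by its differential equation and initial value.\<close>

locale damped_oscillator =
  fixes \<omega> :: real and p p' A y x z :: "real \<Rightarrow> real"
  assumes omega_pos: "\<omega> > 0"
    and p_deriv: "\<And>t. t \<ge> 0 \<Longrightarrow> (p has_real_derivative p' t) (at t within {0..})"
    and p'_cont: "continuous_on {0..} p'"
    and p_pos: "\<And>t. t \<ge> 0 \<Longrightarrow> p t > 0"
    and p'_neg: "\<And>t. t \<ge> 0 \<Longrightarrow> p' t < 0"
    and p2_bounded: "\<exists>K. \<forall>t\<ge>0. integral {0..t} (\<lambda>s. (p s)\<^sup>2) \<le> K"
    and A_deriv: "\<And>t. t \<ge> 0 \<Longrightarrow> (A has_real_derivative p t / 2 * A t) (at t within {0..})"
    and A_0: "A 0 = 1"
    and A_pos: "\<And>t. A t > 0"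
    and A_lim: "filterlim A at_top at_top"
    and y_cont: "continuous_on {0..} y"
    and x_deriv: "\<And>t. t \<ge> 0 \<Longrightarrow> (x has_real_derivative z t + y t) (at t within {0..})"
    and z_deriv: "\<And>t. t \<ge> 0 \<Longrightarrow>
      (z has_real_derivative - \<omega>\<^sup>2 * x t - p t * z t + (\<omega>\<^sup>2 - p t) * y t) (at t within {0..})"
    and x_0: "x 0 = 0" and z_0: "z 0 = 0"
begin

lemmas p_cont = DERIV_atLeast_imp_continuous_on[OF p_deriv]
lemmas A_cont = DERIV_atLeast_imp_continuous_on[OF A_deriv]
lemmas x_cont = DERIV_atLeast_imp_continuous_on[OF x_deriv]
lemmas z_cont = DERIV_atLeast_imp_continuous_on[OF z_deriv]
lemmas conts = p_cont p'_cont A_cont x_cont z_cont y_cont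

section \<open>Growth of \<open>A\<close> and decay of \<open>p\<close>\<close>

lemma A_nonzero [simp]: "A t \<noteq> 0"
  using A_pos[of t] by simp

lemma p_antimono: "0 \<le> s \<Longrightarrow> s \<le> t \<Longrightarrow> p t \<le> p s"
proof (rule DERIV_nonpos_imp_decreasing_open[where f = p])
  show "\<exists>d. (p has_real_derivative d) (at u) \<and> d \<le> 0" if "0 \<le> s" "s < u" "u < t" for u
    using p_deriv[of u] p'_neg[of u] that by (auto simp: at_within_interior[of u "{0..}"] intro: less_imp_le)
qed (auto intro: continuous_on_subset[OF p_cont])

lemma A_mono: "mono_on {0..} A"
proof (rule mono_onI, rule DERIV_nonneg_imp_increasing_open[where f = A])
  fix s t u :: real assume "s \<in> {0..}" "s < u" "u < t"
  then show "\<exists>d. (A has_real_derivative d) (at u) \<and> d \<ge> 0"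
    using A_deriv[of u] p_pos[of u] A_pos[of u]
    by (intro exI[of _ "p u / 2 * A u"]) (auto simp: at_within_interior[of u "{0..}"])
qed (auto intro: continuous_on_subset[OF A_cont])

text \<open>As \<open>p\<close> decreases, \<open>p t \<ge> e\<close> forces p^2 \<ge> e^2 on all of
  [0,t], so that t e^2 is at most the bound \<open>K\<close> on the integral of p^2. This fails for
  t > K / e^2.\<close>

lemma p_tendsto_0: "(p \<longlongrightarrow> 0) at_top"
proof (rule tendstoI)
  fix e :: real assume "e > 0"
  obtain K where K: "\<And>t. t \<ge> 0 \<Longrightarrow> integral {0..t} (\<lambda>s. (p s)\<^sup>2) \<le> K"
    using p2_bounded by blast
  have "eventually (\<lambda>t. t > max 0 (K / e\<^sup>2)) at_top" by (rule eventually_gt_at_top)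
  then show "eventually (\<lambda>t. dist (p t) 0 < e) at_top"
  proof eventually_elim
    case (elim t)
    have "p t < e"
    proof (rule ccontr)
      assume ge: "\<not> p t < e"
      have "t * e\<^sup>2 = integral {0..t} (\<lambda>s. e\<^sup>2)" using elim by simp
      also have "\<dots> \<le> integral {0..t} (\<lambda>s. (p s)\<^sup>2)"
      proof (rule integral_le)
        show "e\<^sup>2 \<le> (p s)\<^sup>2" if "s \<in> {0..t}" for s
          using p_antimono[of s t] ge that \<open>e > 0\<close> by (intro power_mono) auto
      qed (auto intro!: integrable_on_atLeastAtMost_if_continuous_on_atLeast[of 0] continuous_intros p_cont)
      also have "\<dots> \<le> K" using K elim by simp
      finally show False using elim \<open>e > 0\<close> by (simp add: field_simps)
    qed
    then show ?case using p_pos[of t] elim by simp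
  qed
qed

section \<open>Rotating-frame quantities and their derivatives\<close>

definition E :: "real \<Rightarrow> complex" where "E t = cis (- (\<omega> * t))"

text \<open>Rotating-frame coordinate: a solution of the undamped, unforced equation with \<open>A = 1\<close>
  has constant \<open>V\<close>.\<close>

definition V :: "real \<Rightarrow> complex" where
  "V t = A t * E t * (z t + (\<i> * \<omega>) * x t)"

text \<open>The real part is the cosine integral of condition (C) and the imaginary part is minus
  the sine integral.\<close>

definition J :: "real \<Rightarrow> complex" where
  "J t = integral {0..t} (\<lambda>s. A s * y s * E s)"

text \<open>The middle summand is the boundary term of the integration by parts that removes the
  oscillating part of the derivative of \<open>V\<close>.\<close>

definition Q :: "real \<Rightarrow> complex" where
  "Q t = V t + \<i> / (4 * \<omega>) * (p t * ((E t)\<^sup>2 * cnj (V t))) - (\<omega>\<^sup>2 + \<i> * \<omega>) * J t"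

lemma E_deriv: "(E has_vector_derivative - \<i> * \<omega> * E t) (at t within S)"
  unfolding E_def has_vector_derivative_complex_iff
  by (auto intro!: derivative_eq_intros)

lemma E_cnj [simp]: "E t * cnj (E t) = 1" "E t * (cnj (E t) * w) = w" "norm (E t) = 1"
  by (simp_all add: E_def cis_cnj cis_mult mult.assoc[symmetric])

lemma E_cont: "continuous_on S E"
  unfolding E_def by (intro continuous_intros)

lemma real_deriv_imp_complex:
  "(f has_real_derivative f') (at t within S) \<Longrightarrow>
   ((\<lambda>t. complex_of_real (f t)) has_vector_derivative of_real f') (at t within S)"
  by (simp add: has_real_derivative_iff_has_vector_derivative has_vector_derivative_of_real)

text \<open>Put w = z + i omega x. The derivative of \<open>E\<close> cancels the term i omega w in
  w'. The damping is p z = (p/2)(w + \<open>cnj\<close> w), whose first half is cancelled by the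
  derivative of \<open>A\<close>; the second half gives the conjugate term because \<open>E\<close>
  has modulus 1.\<close>

lemma V_deriv:
  assumes "t \<ge> 0"
  shows "(V has_vector_derivative
    (\<omega>\<^sup>2 + \<i> * \<omega> - p t) * (A t * y t * E t) - p t / 2 * ((E t)\<^sup>2 * cnj (V t))) (at t within {0..})"
proof -
  note d = real_deriv_imp_complex[OF A_deriv[OF assms]] real_deriv_imp_complex[OF x_deriv[OF assms]]
    real_deriv_imp_complex[OF z_deriv[OF assms]]
  have eq: "(E t)\<^sup>2 * cnj (V t) = A t * E t * (z t - \<i> * \<omega> * x t)"
    by (simp add: V_def power2_eq_square mult_ac)
  show ?thesis unfolding V_def[abs_def]
    by (rule has_vector_derivative_eq_rhs, (rule d has_vector_derivative_add has_vector_derivative_mult_right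
          has_vector_derivative_mult E_deriv)+, unfold V_def[symmetric] eq)
      (simp add: field_simps power2_eq_square)
qed

text \<open>The last term, with the nonzero factor -2 i omega, permits the integration by parts: it
  expresses the oscillating quantity by a derivative plus terms that contain \<open>p\<close> or
  \<open>y\<close>.\<close>

lemma E2_cnj_V_deriv:
  assumes "t \<ge> 0"
  shows "((\<lambda>t. (E t)\<^sup>2 * cnj (V t)) has_vector_derivative
     (\<omega>\<^sup>2 - \<i> * \<omega> - p t) * (A t * y t * E t) - p t / 2 * V t
     - 2 * \<i> * \<omega> * ((E t)\<^sup>2 * cnj (V t))) (at t within {0..})"
proof -
  have E2: "((\<lambda>t. (E t)\<^sup>2) has_vector_derivative - 2 * \<i> * \<omega> * (E t)\<^sup>2) (at t within {0..})"
    unfolding power2_eq_square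
    by (rule has_vector_derivative_eq_rhs[OF has_vector_derivative_mult[OF E_deriv E_deriv]])
      (simp add: algebra_simps)
  show ?thesis
    by (rule has_vector_derivative_eq_rhs[OF has_vector_derivative_mult[OF E2
            has_vector_derivative_cnj[OF V_deriv[OF assms]]]])
      (simp add: power2_eq_square algebra_simps)
qed

text \<open>Since i/(4 omega) times -2 i omega is 1/2, the boundary term in \<open>Q\<close> cancels
  the oscillating term of V'. Subtracting the multiple of \<open>J\<close> removes the main forcing;
  every remaining term carries p', p^2 or p A y.\<close>

lemma Q_deriv:
  assumes "t \<ge> 0"
  shows "(Q has_vector_derivative
     \<i> / (4 * \<omega>) * (p' t * ((E t)\<^sup>2 * cnj (V t)) - (p t)\<^sup>2 / 2 * V t
        + p t * (\<omega>\<^sup>2 - \<i> * \<omega> - p t) * (A t * y t * E t)) - p t * (A t * y t * E t)) (at t within {0..})"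
proof -
  have J: "(J has_vector_derivative A t * y t * E t) (at t within {0..})"
    unfolding J_def by (rule integral_has_vector_derivative_atLeast[OF _ assms])
      (intro continuous_intros conts E_cont)
  show ?thesis unfolding Q_def[abs_def]
    by (rule has_vector_derivative_eq_rhs, (rule has_vector_derivative_add has_vector_derivative_diff
        has_vector_derivative_mult_right has_vector_derivative_mult
        real_deriv_imp_complex p_deriv V_deriv[OF assms] E2_cnj_V_deriv[OF assms] J assms)+)
      (use omega_pos in \<open>simp add: field_simps power2_eq_square\<close>)
qed

section \<open>Integral bound for \<open>Q\<close>\<close>

lemma V_cont: "continuous_on {0..} V"
  unfolding V_def by (intro continuous_intros conts E_cont)

lemma norm_V: "norm (V t) = A t * norm (z t + (\<i> * \<omega>) * x t)"
  using A_pos[of t] by (simp add: V_def norm_mult)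

lemma A_ge_1: "t \<ge> 0 \<Longrightarrow> A t \<ge> 1"
  using mono_onD[OF A_mono, of 0 t] A_0 by simp

text \<open>The weight of \<open>norm (V t)\<close> in the bound for the derivative of
  \<open>Q\<close>: the terms with p' and p^2 together.\<close>

definition g :: "real \<Rightarrow> real" where "g t = (p t)\<^sup>2 - p' t"

lemma g_cont: "continuous_on {0..} g"
  unfolding g_def by (intro continuous_intros conts)

lemma g_nonneg: "t \<ge> 0 \<Longrightarrow> g t \<ge> 0"
  using p'_neg[of t] zero_le_power2[of "p t"] unfolding g_def by linarith

text \<open>The part -p' telescopes to p 0 - p t, which is below p 0 as \<open>p\<close> is
  positive.\<close>

lemma g_bounded: "\<exists>K. \<forall>t\<ge>0. integral {0..t} g \<le> K"
proof -
  obtain K where K: "\<And>t. t \<ge> 0 \<Longrightarrow> integral {0..t} (\<lambda>s. (p s)\<^sup>2) \<le> K"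
    using p2_bounded by blast
  have "integral {0..t} g \<le> K + p 0" if "t \<ge> 0" for t
  proof -
    have "integral {0..t} g = integral {0..t} (\<lambda>s. (p s)\<^sup>2) - integral {0..t} p'"
      unfolding g_def
      by (intro Henstock_Kurzweil_Integration.integral_diff
          integrable_on_atLeastAtMost_if_continuous_on_atLeast[of 0] continuous_intros conts) auto
    also have "integral {0..t} p' = p t - p 0"
      using p_deriv that by (intro integral_eq_diff_atLeast[of 0])
        (auto simp: has_real_derivative_iff_has_vector_derivative)
    finally show ?thesis using K[OF that] p_pos[OF that] by simp
  qed
  then show ?thesis by blast
qed

text \<open>\<open>Q\<close> vanishes at 0, so its norm is at most the integral of the norm of its
  derivative. The forcing part is written with the weight p A / 2 because that is the derivative of
  \<open>A\<close>.\<close>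

lemma Q_bound:
  obtains C1 C2 where "C1 \<ge> 0" "C2 \<ge> 0" "\<And>t. t \<ge> 0 \<Longrightarrow> norm (Q t) \<le>
    C1 * integral {0..t} (\<lambda>s. g s * norm (V s)) + C2 * integral {0..t} (\<lambda>s. p s / 2 * A s * \<bar>y s\<bar>)"
proof
  \<comment> \<open>\<open>C1\<close> is the norm of i/(4 omega), and \<open>D\<close> bounds
    omega^2 - i omega - p because p \<le> p 0. \<open>C2\<close> adds the two contributions of p A y
    and is doubled because its weight is p/2.\<close>
  define C1 where "C1 = 1 / (4 * \<omega>)"
  define D where "D = \<omega>\<^sup>2 + \<omega> + p 0"
  define C2 where "C2 = 2 * (1 + C1 * D)"
  have nonneg: "C1 \<ge> 0" "D \<ge> 0" using omega_pos p_pos[of 0] by (auto simp: C1_def D_def)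
  show "C1 \<ge> 0" "C2 \<ge> 0" using nonneg by (auto simp: C2_def)
  fix t :: real assume t: "t \<ge> 0"
  have "norm (Q t - Q 0) \<le>
    integral {0..t} (\<lambda>s. C1 * (g s * norm (V s)) + C2 * (p s / 2 * A s * \<bar>y s\<bar>))"
  proof (rule norm_diff_le_integral_atLeast[OF Q_deriv _ _ t])
    show "continuous_on {0..} (\<lambda>s. C1 * (g s * norm (V s)) + C2 * (p s / 2 * A s * \<bar>y s\<bar>))"
      by (intro continuous_intros conts V_cont g_cont) auto
    fix s :: real assume s: "s \<ge> 0"
    define b where "b = A s * \<bar>y s\<bar>"
    have b: "b \<ge> 0" "norm (A s * y s * E s) = b" using A_pos[of s]
      by (auto simp: b_def norm_mult abs_mult)
    have nd: "norm (\<omega>\<^sup>2 - \<i> * \<omega> - p s) \<le> D"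
    proof -
      have "norm (\<omega>\<^sup>2 - \<i> * \<omega> - p s) \<le> norm (complex_of_real (\<omega>\<^sup>2)) + norm (\<i> * \<omega>) + norm (complex_of_real (p s))"
        by (intro order_trans[OF norm_triangle_ineq4] add_mono order_refl)
      also have "\<dots> \<le> D" using p_antimono[of 0 s] p_pos[of s] s omega_pos
        by (simp add: D_def norm_mult norm_power)
      finally show ?thesis .
    qed
    have n1: "norm (p' s * ((E s)\<^sup>2 * cnj (V s))) = - p' s * norm (V s)"
      using p'_neg[OF s] by (simp add: norm_mult norm_power)
    have n2: "norm ((p s)\<^sup>2 / 2 * V s) \<le> (p s)\<^sup>2 * norm (V s)"
      by (simp add: norm_mult norm_power norm_divide)
    have n3: "norm (p s * (\<omega>\<^sup>2 - \<i> * \<omega> - p s) * (A s * y s * E s)) \<le> p s * D * b"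
      unfolding norm_mult[of _ "A s * y s * E s"] b(2) using nd p_pos[OF s] b(1)
      by (intro mult_right_mono) (auto simp: norm_mult)
    have n4: "norm (p s * (A s * y s * E s)) = p s * b"
      unfolding norm_mult[of _ "A s * y s * E s"] b(2) using p_pos[OF s] by simp
    have "norm (p' s * ((E s)\<^sup>2 * cnj (V s)) - (p s)\<^sup>2 / 2 * V s
        + p s * (\<omega>\<^sup>2 - \<i> * \<omega> - p s) * (A s * y s * E s))
      \<le> - p' s * norm (V s) + (p s)\<^sup>2 * norm (V s) + p s * D * b"
      using n1 n2 n3 by (intro norm_triangle_le add_mono norm_triangle_le_diff) auto
    then have "norm (\<i> / (4 * \<omega>) * (p' s * ((E s)\<^sup>2 * cnj (V s)) - (p s)\<^sup>2 / 2 * V s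
        + p s * (\<omega>\<^sup>2 - \<i> * \<omega> - p s) * (A s * y s * E s)))
      \<le> C1 * (- p' s * norm (V s) + (p s)\<^sup>2 * norm (V s) + p s * D * b)"
      using omega_pos nonneg by (simp only: norm_mult)
        (intro mult_mono, auto simp: C1_def norm_divide)
    then have "norm (\<i> / (4 * \<omega>) * (p' s * ((E s)\<^sup>2 * cnj (V s)) - (p s)\<^sup>2 / 2 * V s
        + p s * (\<omega>\<^sup>2 - \<i> * \<omega> - p s) * (A s * y s * E s)) - p s * (A s * y s * E s))
      \<le> C1 * (- p' s * norm (V s) + (p s)\<^sup>2 * norm (V s) + p s * D * b) + p s * b"
      using n4 by (intro norm_triangle_le_diff add_mono) auto
    also have "\<dots> = C1 * (g s * norm (V s)) + C2 * (p s / 2 * A s * \<bar>y s\<bar>)"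
      by (simp add: g_def C2_def b_def algebra_simps)
    finally show "norm (\<i> / (4 * \<omega>) * (p' s * ((E s)\<^sup>2 * cnj (V s)) - (p s)\<^sup>2 / 2 * V s
        + p s * (\<omega>\<^sup>2 - \<i> * \<omega> - p s) * (A s * y s * E s)) - p s * (A s * y s * E s)) \<le> \<dots>" .
  qed
  also have "\<dots> = C1 * integral {0..t} (\<lambda>s. g s * norm (V s))
      + C2 * integral {0..t} (\<lambda>s. p s / 2 * A s * \<bar>y s\<bar>)"
    by (subst Henstock_Kurzweil_Integration.integral_add)
      (auto intro!: integrable_on_atLeastAtMost_if_continuous_on_atLeast[of 0] continuous_intros conts V_cont g_cont)
  also have "Q 0 = 0" by (simp add: Q_def V_def J_def x_0 z_0)
  finally show "norm (Q t) \<le> C1 * integral {0..t} (\<lambda>s. g s * norm (V s))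
      + C2 * integral {0..t} (\<lambda>s. p s / 2 * A s * \<bar>y s\<bar>)" by simp
qed

section \<open>Smallness of the error terms and the a priori bound on \<open>V\<close>\<close>

lemma integral_g_V_smallo:
  assumes "\<And>t. t \<ge> 0 \<Longrightarrow> norm (V t) \<le> M * A t"
  shows "(\<lambda>t. integral {0..t} (\<lambda>s. g s * norm (V s))) \<in> o[at_top](A)"
proof -
  obtain K where "\<And>t. t \<ge> 0 \<Longrightarrow> integral {0..t} g \<le> K" using g_bounded by blast
  then show ?thesis
    by (intro integral_mult_bigo_smallo[where K = K and M = M] A_lim A_mono A_pos g_cont g_nonneg
        assms continuous_intros V_cont) auto
qed

lemma norm_correction: "t \<ge> 0 \<Longrightarrow>
  norm (\<i> / (4 * \<omega>) * (p t * ((E t)\<^sup>2 * cnj (V t)))) = 1 / (4 * \<omega>) * (p t * norm (V t))"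
  using omega_pos p_pos[of t] by (simp add: norm_mult norm_divide norm_power)

lemma correction_smallo:
  assumes "\<And>t. t \<ge> 0 \<Longrightarrow> norm (V t) \<le> M * A t"
  shows "(\<lambda>t. p t * norm (V t)) \<in> o[at_top](A)"
proof -
  have "p \<in> o[at_top](\<lambda>_. 1)" using p_tendsto_0 by (intro smalloI_tendsto) auto
  moreover have "(\<lambda>t. norm (V t)) \<in> O[at_top](A)"
    using assms A_pos by (intro bigoI[of _ M] eventually_at_top_linorderI[of 0])
      (auto simp: abs_of_pos)
  ultimately show ?thesis using landau_o.small_big_mult by fastforce
qed

text \<open>The weight is the derivative of \<open>A\<close>, so the averaging principle applies
  with \<psi> = |y|.\<close>

lemma p_A_y_smallo:
  assumes "(y \<longlongrightarrow> 0) at_top"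
  shows "(\<lambda>t. integral {0..t} (\<lambda>s. p s / 2 * A s * \<bar>y s\<bar>)) \<in> o[at_top](A)"
  using assms p_pos A_pos
  by (intro integral_deriv_mult_smallo A_lim A_deriv continuous_intros conts tendsto_rabs_zero)
    (auto intro: less_imp_le)

text \<open>Solve the definition of \<open>Q\<close> for \<open>V\<close>, absorb the boundary term
  into the left side once \<open>p\<close> is small, and apply Gronwall's inequality to
  \<open>norm (V t) / A t\<close>, whose weight \<open>g\<close> has bounded integral.\<close>

lemma V_bounded:
  assumes y: "(y \<longlongrightarrow> 0) at_top" and J: "(\<lambda>t. norm (J t)) \<in> o[at_top](A)"
  shows "\<exists>M. \<forall>t\<ge>0. norm (V t) \<le> M * A t"
proof -
  obtain C1 C2 where C: "C1 \<ge> 0" "C2 \<ge> 0" and Q: "\<And>t. t \<ge> 0 \<Longrightarrow> norm (Q t) \<le>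
    C1 * integral {0..t} (\<lambda>s. g s * norm (V s)) + C2 * integral {0..t} (\<lambda>s. p s / 2 * A s * \<bar>y s\<bar>)"
    using Q_bound by blast
  obtain K where K: "\<And>t. t \<ge> 0 \<Longrightarrow> integral {0..t} g \<le> K" using g_bounded by blast
  define c where "c = \<omega>\<^sup>2 + \<i> * \<omega>"
  define h where "h = (\<lambda>t. norm c * norm (J t) + C2 * integral {0..t} (\<lambda>s. p s / 2 * A s * \<bar>y s\<bar>))"
  have "h \<in> o[at_top](A)" unfolding h_def
    using J p_A_y_smallo[OF y] by (intro sum_in_smallo landau_o.small.cmult_in_iff') auto
  then have "eventually (\<lambda>t. norm (h t) \<le> 1 * norm (A t)) at_top"
    by (rule landau_o.smallD) simp
  \<comment> \<open>Below this threshold the boundary term is at most half of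
    \<open>norm (V t)\<close>.\<close>
  moreover have "eventually (\<lambda>t. p t < 2 * \<omega>) at_top"
    using p_tendsto_0 omega_pos by (intro order_tendstoD) auto
  ultimately have "eventually (\<lambda>t. h t \<le> A t \<and> p t \<le> 2 * \<omega>) at_top"
    by eventually_elim (use A_pos in \<open>force simp: abs_of_pos\<close>)
  then obtain T where T: "\<And>t. t \<ge> T \<Longrightarrow> h t \<le> A t \<and> p t \<le> 2 * \<omega>"
    by (auto simp: eventually_at_top_linorder)
  have "compact (V ` {0..T})"
    by (intro compact_continuous_image continuous_on_subset[OF V_cont]) auto
  then obtain M0 where M0: "M0 > 0" "\<And>t. t \<in> {0..T} \<Longrightarrow> norm (V t) \<le> M0"
    by (metis bounded_pos compact_imp_bounded image_eqI)
  define r where "r = (\<lambda>t. norm (V t) / A t)"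
  have r_cont: "continuous_on {0..} r"
    unfolding r_def by (rule continuous_on_divide[OF continuous_on_norm[OF V_cont] A_cont]) auto
  have gV_nonneg: "integral {0..t} (\<lambda>s. g s * norm (V s)) \<ge> 0" for t
    by (intro integral_nonneg integrable_on_atLeastAtMost_if_continuous_on_atLeast[of 0]
        continuous_intros V_cont g_cont) (auto intro!: mult_nonneg_nonneg g_nonneg)
  \<comment> \<open>The summand \<open>M0\<close> covers t \<le> T, where A \<ge> 1 is used. The
    factors 2 arise for t > T from moving half of \<open>norm (V t)\<close> to the left.\<close>
  have V_le: "norm (V t) \<le> (2 + M0) * A t + 2 * C1 * integral {0..t} (\<lambda>s. g s * norm (V s))"
    if t: "t \<ge> 0" for t
  proof (cases "t \<le> T")
    case True
    have "norm (V t) \<le> M0 * 1" using M0(2)[of t] True t by simp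
    also have "\<dots> \<le> (2 + M0) * A t" using A_ge_1[OF t] M0(1) by (intro mult_mono) auto
    also have "\<dots> \<le> \<dots> + 2 * C1 * integral {0..t} (\<lambda>s. g s * norm (V s))"
      using C gV_nonneg by simp
    finally show ?thesis .
  next
    case False
    have "V t = Q t - \<i> / (4 * \<omega>) * (p t * ((E t)\<^sup>2 * cnj (V t))) + c * J t"
      by (simp add: Q_def c_def)
    then have "norm (V t) \<le> norm (Q t) + 1 / (4 * \<omega>) * (p t * norm (V t)) + norm c * norm (J t)"
      by (metis add_mono norm_correction[OF t] norm_mult norm_triangle_ineq4 norm_triangle_le order_refl)
    also have "1 / (4 * \<omega>) * (p t * norm (V t)) \<le> 1 / (4 * \<omega>) * (2 * \<omega> * norm (V t))"
      using T[of t] False omega_pos by (intro mult_left_mono mult_right_mono) auto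
    also have "\<dots> = norm (V t) / 2" using omega_pos by simp
    finally have "norm (V t) / 2 \<le> C1 * integral {0..t} (\<lambda>s. g s * norm (V s)) + h t"
      using Q[OF t] by (simp add: h_def)
    also have "h t \<le> A t" using T[of t] False by simp
    finally have "norm (V t) \<le> 2 * A t + 2 * C1 * integral {0..t} (\<lambda>s. g s * norm (V s))"
      by simp
    also have "\<dots> \<le> (2 + M0) * A t + 2 * C1 * integral {0..t} (\<lambda>s. g s * norm (V s))"
      using M0(1) A_pos[of t] by simp
    finally show ?thesis .
  qed
  \<comment> \<open>Monotonicity of \<open>A\<close> replaces \<open>A s\<close> by
    \<open>A t\<close> under the integral; the latter then cancels on division.\<close>
  have r_le: "r t \<le> (2 + M0) + 2 * C1 * integral {0..t} (\<lambda>s. g s * r s)" if t: "t \<ge> 0" for t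
  proof -
    have "integral {0..t} (\<lambda>s. g s * norm (V s)) \<le> integral {0..t} (\<lambda>s. A t * (g s * r s))"
    proof (rule integral_le)
      show "g s * norm (V s) \<le> A t * (g s * r s)" if s: "s \<in> {0..t}" for s
      proof -
        have "norm (V s) = A s * r s" using A_pos[of s] by (simp add: r_def)
        also have "\<dots> \<le> A t * r s" using s A_pos[of s]
          by (intro mult_right_mono mono_onD[OF A_mono]) (auto simp: r_def)
        finally show ?thesis using g_nonneg[of s] s
          by (metis atLeastAtMost_iff mult.left_commute mult_left_mono)
      qed
    qed (auto intro!: integrable_on_atLeastAtMost_if_continuous_on_atLeast[of 0] continuous_intros
        V_cont g_cont r_cont)
    then have "2 * C1 * integral {0..t} (\<lambda>s. g s * norm (V s))
        \<le> 2 * C1 * (A t * integral {0..t} (\<lambda>s. g s * r s))"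
      using C by (intro mult_left_mono) (auto simp only: integral_mult_right)
    with V_le[OF t]
    have "norm (V t) \<le> (2 + M0) * A t + 2 * C1 * (A t * integral {0..t} (\<lambda>s. g s * r s))"
      by (rule order_trans[OF _ add_left_mono])
    then show ?thesis using A_pos[of t] by (simp add: r_def field_simps)
  qed
  have "norm (V t) \<le> ((2 + M0) * exp (2 * C1 * K)) * A t" if t: "t \<ge> 0" for t
  proof -
    have "r t \<le> (2 + M0) * exp (2 * C1 * integral {0..t} g)"
      using C t by (intro gronwall_integral g_cont g_nonneg r_cont r_le) auto
    also have "\<dots> \<le> (2 + M0) * exp (2 * C1 * K)"
      using K[OF t] C M0(1) by (intro mult_left_mono) (auto intro!: mult_left_mono)
    finally show ?thesis using A_pos[of t] by (simp add: r_def field_simps)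
  qed
  then show ?thesis by blast
qed

text \<open>\<open>norm (V t) / A t\<close> is the modulus of z + i omega x, whose real and
  imaginary parts are z and omega x.\<close>

lemma V_smallo_iff: "(\<lambda>t. norm (V t)) \<in> o[at_top](A) \<longleftrightarrow> (x \<longlongrightarrow> 0) at_top \<and> (z \<longlongrightarrow> 0) at_top"
proof -
  have "(\<lambda>t. norm (V t)) \<in> o[at_top](A) \<longleftrightarrow> ((\<lambda>t. norm (V t) / A t) \<longlongrightarrow> 0) at_top"
    by (auto intro: smalloD_tendsto smalloI_tendsto)
  also have "\<dots> \<longleftrightarrow> ((\<lambda>t. norm (z t + (\<i> * \<omega>) * x t)) \<longlongrightarrow> 0) at_top"
    by (simp add: norm_V)
  also have "\<dots> \<longleftrightarrow> ((\<lambda>t. z t + (\<i> * \<omega>) * x t) \<longlongrightarrow> 0) at_top"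
    by (rule tendsto_norm_zero_iff)
  also have "\<dots> \<longleftrightarrow> (z \<longlongrightarrow> 0) at_top \<and> ((\<lambda>t. \<omega> * x t) \<longlongrightarrow> 0) at_top"
    by (simp add: tendsto_complex_iff)
  also have "((\<lambda>t. \<omega> * x t) \<longlongrightarrow> 0) at_top \<longleftrightarrow> (x \<longlongrightarrow> 0) at_top"
    using omega_pos tendsto_mult_left_iff[of \<omega> x 0] by simp
  finally show ?thesis by blast
qed

text \<open>Whenever V = O(A), \<open>V\<close> and (omega^2 + i omega) J differ by o(A), and the
  factor is nonzero. The bound on \<open>V\<close> comes from Gronwall when \<open>J\<close> is
  small and is immediate when \<open>V\<close> is.\<close>

lemma J_smallo_iff:
  assumes y: "(y \<longlongrightarrow> 0) at_top"
  shows "(\<lambda>t. norm (J t)) \<in> o[at_top](A) \<longleftrightarrow> (x \<longlongrightarrow> 0) at_top \<and> (z \<longlongrightarrow> 0) at_top"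
proof -
  define c where "c = \<omega>\<^sup>2 + \<i> * \<omega>"
  have c: "c \<noteq> 0" using omega_pos by (simp add: c_def complex_eq_iff)
  have diff: "(\<lambda>t. norm (V t - c * J t)) \<in> o[at_top](A)" if M: "\<And>t. t \<ge> 0 \<Longrightarrow> norm (V t) \<le> M * A t" for M
  proof -
    obtain C1 C2 where C: "C1 \<ge> 0" "C2 \<ge> 0" and Q: "\<And>t. t \<ge> 0 \<Longrightarrow> norm (Q t) \<le>
      C1 * integral {0..t} (\<lambda>s. g s * norm (V s)) + C2 * integral {0..t} (\<lambda>s. p s / 2 * A s * \<bar>y s\<bar>)"
      using Q_bound by blast
    define C3 where "C3 = 1 / (4 * \<omega>)"
    define H where "H = (\<lambda>t. C1 * integral {0..t} (\<lambda>s. g s * norm (V s))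
      + C2 * integral {0..t} (\<lambda>s. p s / 2 * A s * \<bar>y s\<bar>) + C3 * (p t * norm (V t)))"
    have "H \<in> o[at_top](A)" unfolding H_def
      using integral_g_V_smallo[OF M] p_A_y_smallo[OF y] correction_smallo[OF M]
      by (intro sum_in_smallo) (auto intro: landau_o.small.cmult_in_iff')
    moreover have "norm (V t - c * J t) \<le> H t" if t: "t \<ge> 0" for t
    proof -
      have "V t - c * J t = Q t - \<i> / (4 * \<omega>) * (p t * ((E t)\<^sup>2 * cnj (V t)))"
        by (simp add: Q_def c_def)
      also have "norm \<dots> \<le> H t"
        using Q[OF t] norm_correction[OF t] by (intro norm_triangle_le_diff) (simp add: H_def C3_def)
      finally show ?thesis .
    qed
    then have "(\<lambda>t. norm (V t - c * J t)) \<in> O[at_top](H)"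
      by (intro bigoI[of _ 1] eventually_at_top_linorderI[of 0]) force
    ultimately show ?thesis by (rule landau_o.big_small_trans[rotated])
  qed
  have "(\<lambda>t. norm (V t)) \<in> o[at_top](A)" if J: "(\<lambda>t. norm (J t)) \<in> o[at_top](A)"
  proof -
    obtain M where M: "\<And>t. t \<ge> 0 \<Longrightarrow> norm (V t) \<le> M * A t" using V_bounded[OF y J] by blast
    have "(\<lambda>t. norm (V t - c * J t) + norm c * norm (J t)) \<in> o[at_top](A)"
      using diff[OF M] J by (intro sum_in_smallo) auto
    moreover have "norm (V t) \<le> norm (V t - c * J t) + norm c * norm (J t)" for t
      using norm_triangle_ineq[of "V t - c * J t" "c * J t"] by (simp add: norm_mult)
    then have "(\<lambda>t. norm (V t)) \<in> O[at_top](\<lambda>t. norm (V t - c * J t) + norm c * norm (J t))"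
      by (intro bigoI[of _ 1] always_eventually allI) force
    ultimately show ?thesis by (rule landau_o.big_small_trans[rotated])
  qed
  moreover have "(\<lambda>t. norm (J t)) \<in> o[at_top](A)" if V: "(\<lambda>t. norm (V t)) \<in> o[at_top](A)"
  proof -
    \<comment> \<open>\<open>diff\<close> asks for a bound on the whole half-line: little-o supplies
      it from some \<open>T\<close> on, and compactness with A \<ge> 1 supplies it before
      \<open>T\<close>.\<close>
    have "eventually (\<lambda>t. norm (norm (V t)) \<le> 1 * norm (A t)) at_top"
      by (rule landau_o.smallD[OF V]) simp
    then obtain T where T: "\<And>t. t \<ge> T \<Longrightarrow> norm (V t) \<le> A t"
      using A_pos by (auto simp: eventually_at_top_linorder abs_of_pos)
    have "compact (V ` {0..T})"
      by (intro compact_continuous_image continuous_on_subset[OF V_cont]) auto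
    then obtain M0 where M0: "M0 > 0" "\<And>t. t \<in> {0..T} \<Longrightarrow> norm (V t) \<le> M0"
      by (metis bounded_pos compact_imp_bounded image_eqI)
    have M: "norm (V t) \<le> (1 + M0) * A t" if t: "t \<ge> 0" for t
    proof (cases "t \<le> T")
      case True
      have "norm (V t) \<le> M0 * 1" using M0(2)[of t] True t by simp
      also have "\<dots> \<le> (1 + M0) * A t" using A_ge_1[OF t] M0(1) by (intro mult_mono) auto
      finally show ?thesis .
    next
      case False
      have "norm (V t) \<le> 1 * A t" using T[of t] False by simp
      also have "\<dots> \<le> (1 + M0) * A t" using A_pos[of t] M0(1) by (intro mult_right_mono) auto
      finally show ?thesis .
    qed
    have "(\<lambda>t. norm (V t) + norm (V t - c * J t)) \<in> o[at_top](A)"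
      using diff[OF M] V by (intro sum_in_smallo)
    moreover have "norm c * norm (J t) \<le> norm (V t) + norm (V t - c * J t)" for t
      using norm_triangle_ineq4[of "V t" "V t - c * J t"] by (simp add: norm_mult)
    then have "(\<lambda>t. norm c * norm (J t)) \<in> O[at_top](\<lambda>t. norm (V t) + norm (V t - c * J t))"
      by (intro bigoI[of _ 1] always_eventually allI) force
    ultimately have "(\<lambda>t. norm c * norm (J t)) \<in> o[at_top](A)" by (rule landau_o.big_small_trans[rotated])
    then show ?thesis using c by simp
  qed
  ultimately show ?thesis using V_smallo_iff by blast
qed

text \<open>Writing y = (z + y) - z turns the equation for \<open>z\<close> into z' = -omega^2 z +
  \<phi> with \<phi> tending to 0. Hence \<open>z\<close> tends to 0, and so does
  \<open>y\<close>.\<close>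

lemma y_tendsto_0:
  assumes x: "(x \<longlongrightarrow> 0) at_top" and zy: "((\<lambda>t. z t + y t) \<longlongrightarrow> 0) at_top"
  shows "(y \<longlongrightarrow> 0) at_top"
proof -
  define \<phi> where "\<phi> = (\<lambda>t. (\<omega>\<^sup>2 - p t) * (z t + y t) - \<omega>\<^sup>2 * x t)"
  have phi_cont: "continuous_on {0..} \<phi>" unfolding \<phi>_def by (intro continuous_intros conts)
  have phi: "(\<phi> \<longlongrightarrow> 0) at_top"
    unfolding \<phi>_def by (rule tendsto_eq_intros x zy p_tendsto_0 refl | simp)+
  \<comment> \<open>The integrating factor: (B z)' = B \<phi>. As B' = omega^2 B, the averaging
    principle gives B z = o(B).\<close>
  define B where "B = (\<lambda>t. exp (\<omega>\<^sup>2 * t))"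
  have B_lim: "filterlim B at_top at_top" unfolding B_def using omega_pos
    by (intro filterlim_compose[OF exp_at_top] filterlim_tendsto_pos_mult_at_top[OF tendsto_const] filterlim_ident) auto
  have B_deriv: "(B has_real_derivative \<omega>\<^sup>2 * B t) (at t within S)" for t S
    unfolding B_def by (auto intro!: derivative_eq_intros)
  have Bz: "((\<lambda>t. B t * z t) has_real_derivative B t * \<phi> t) (at t within {0..})" if "t \<ge> 0" for t
    by (rule derivative_eq_intros B_deriv z_deriv that refl)+ (simp add: \<phi>_def algebra_simps)
  have "(\<lambda>t. integral {0..t} (\<lambda>s. \<omega>\<^sup>2 * B s * \<bar>\<phi> s\<bar>)) \<in> o[at_top](B)"
    using phi phi_cont
    by (intro integral_deriv_mult_smallo B_lim B_deriv tendsto_rabs_zero continuous_intros)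
      (auto simp: B_def intro!: continuous_intros)
  moreover have "norm (B t * z t) \<le> 1 / \<omega>\<^sup>2 * norm (integral {0..t} (\<lambda>s. \<omega>\<^sup>2 * B s * \<bar>\<phi> s\<bar>))"
    if t: "t \<ge> 0" for t
  proof -
    have "norm (B t * z t - B 0 * z 0) \<le> integral {0..t} (\<lambda>s. B s * \<bar>\<phi> s\<bar>)"
      using Bz unfolding has_real_derivative_iff_has_vector_derivative
      by (rule norm_diff_le_integral_atLeast[OF _ _ _ t])
        (auto simp: B_def abs_mult intro!: continuous_intros phi_cont)
    also have "\<dots> = 1 / \<omega>\<^sup>2 * integral {0..t} (\<lambda>s. \<omega>\<^sup>2 * B s * \<bar>\<phi> s\<bar>)"
      using omega_pos by (simp add: mult.assoc)
    also have "\<dots> \<le> 1 / \<omega>\<^sup>2 * norm (integral {0..t} (\<lambda>s. \<omega>\<^sup>2 * B s * \<bar>\<phi> s\<bar>))"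
      by (intro mult_left_mono) auto
    finally show ?thesis by (simp add: z_0)
  qed
  then have "(\<lambda>t. B t * z t) \<in> O[at_top](\<lambda>t. integral {0..t} (\<lambda>s. \<omega>\<^sup>2 * B s * \<bar>\<phi> s\<bar>))"
    by (intro bigoI[of _ "1 / \<omega>\<^sup>2"] eventually_at_top_linorderI[of 0]) auto
  ultimately have "(\<lambda>t. B t * z t) \<in> o[at_top](B)" by (rule landau_o.big_small_trans[rotated])
  then have "((\<lambda>t. B t * z t / B t) \<longlongrightarrow> 0) at_top" by (rule smalloD_tendsto)
  then have "(z \<longlongrightarrow> 0) at_top" by (simp add: B_def)
  from tendsto_diff[OF zy this] show ?thesis by simp
qed

end

section \<open>The equivalence\<close>

text \<open>Both |Re J| and |Im J| are at most |J|, which is at most their sum.\<close>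

lemma norm_complex_smallo_iff:
  fixes J :: "'b \<Rightarrow> complex" and A :: "'b \<Rightarrow> real"
  shows "(\<lambda>t. norm (J t)) \<in> o[F](A) \<longleftrightarrow> (\<lambda>t. Re (J t)) \<in> o[F](A) \<and> (\<lambda>t. Im (J t)) \<in> o[F](A)"
proof (intro iffI conjI)
  assume J: "(\<lambda>t. norm (J t)) \<in> o[F](A)"
  have "(\<lambda>t. Re (J t)) \<in> O[F](\<lambda>t. norm (J t))" "(\<lambda>t. Im (J t)) \<in> O[F](\<lambda>t. norm (J t))"
    by (intro bigoI[of _ 1] always_eventually allI; simp add: abs_Re_le_cmod abs_Im_le_cmod)+
  from this[THEN landau_o.big_small_trans, OF J]
  show "(\<lambda>t. Re (J t)) \<in> o[F](A)" "(\<lambda>t. Im (J t)) \<in> o[F](A)" by auto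
next
  assume "(\<lambda>t. Re (J t)) \<in> o[F](A) \<and> (\<lambda>t. Im (J t)) \<in> o[F](A)"
  then have "(\<lambda>t. \<bar>Re (J t)\<bar> + \<bar>Im (J t)\<bar>) \<in> o[F](A)"
    by (intro sum_in_smallo) auto
  moreover have "(\<lambda>t. norm (J t)) \<in> O[F](\<lambda>t. \<bar>Re (J t)\<bar> + \<bar>Im (J t)\<bar>)"
    by (intro bigoI[of _ 1] always_eventually allI) (simp add: cmod_le)
  ultimately show "(\<lambda>t. norm (J t)) \<in> o[F](A)" by (rule landau_o.big_small_trans[rotated])
qed

theorem mainTheorem12:
  fixes \<omega> :: real and p p' f x x' :: "real \<Rightarrow> real"
  assumes omega_pos: "\<omega> > 0"
    and p_deriv: "\<And>t. t \<ge> 0 \<Longrightarrow> (p has_real_derivative p' t) (at t within {0..})"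
    and p'_cont: "continuous_on {0..} p'"
    and p_pos: "\<And>t. t \<ge> 0 \<Longrightarrow> p t > 0"
    and p'_neg: "\<And>t. t \<ge> 0 \<Longrightarrow> p' t < 0"
    and p_int_inf: "filterlim (\<lambda>t. LINT s:{0..t}|lborel. p s) at_top at_top"
    and p2_int: "set_integrable lborel {0..} (\<lambda>t. (p t)\<^sup>2)"
    and f_loc: "\<And>t. t \<ge> 0 \<Longrightarrow> set_integrable lborel {0..t} f"
    and x_deriv: "\<And>t. t \<ge> 0 \<Longrightarrow> (x has_real_derivative x' t) (at t within {0..})"
    and x'_cont: "continuous_on {0..} x'"
    and x_ode: "\<And>t. t \<ge> 0 \<Longrightarrow>
        x' t = x' 0 + (LINT s:{0..t}|lborel. f s - p s * x' s - \<omega>\<^sup>2 * x s)"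
    and x0: "x 0 = 0" and x'0: "x' 0 = 0"
  shows "((y1_fun \<omega> f \<longlongrightarrow> 0) at_top
          \<and> (\<lambda>t. LINT s:{0..t}|lborel. cos (\<omega> * s) * damp_A p s * y1_fun \<omega> f s) \<in> o[at_top](damp_A p)
          \<and> (\<lambda>t. LINT s:{0..t}|lborel. sin (\<omega> * s) * damp_A p s * y1_fun \<omega> f s) \<in> o[at_top](damp_A p))
     \<longleftrightarrow> ((x \<longlongrightarrow> 0) at_top \<and> (x' \<longlongrightarrow> 0) at_top)"
proof -
  define y where "y = y1_fun \<omega> f"
  have p_cont: "continuous_on {0..} p" by (rule DERIV_atLeast_imp_continuous_on[OF p_deriv])
  have x_cont: "continuous_on {0..} x" by (rule DERIV_atLeast_imp_continuous_on[OF x_deriv])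
  have y_cont: "continuous_on {0..} y" unfolding y_def by (rule continuous_on_y1_fun[OF f_loc])
  note A_eq = damp_A_def[of p, unfolded LINT_eq_integral_continuous[OF p_cont]]
  have A_deriv: "(damp_A p has_real_derivative p t / 2 * damp_A p t) (at t within {0..})"
    if "t \<ge> 0" for t
    unfolding A_eq[abs_def]
    by (rule derivative_eq_intros integral_has_real_derivative_atLeast p_cont that refl)+ simp
  have A_0: "damp_A p 0 = 1" and A_pos: "damp_A p t > 0" for t by (simp_all add: A_eq)
  have A_lim: "filterlim (damp_A p) at_top at_top"
    unfolding damp_A_def[abs_def] using p_int_inf
    by (intro filterlim_compose[OF exp_at_top] filterlim_tendsto_pos_mult_at_top[OF tendsto_const]) auto
  have p2_bounded: "\<exists>K. \<forall>t\<ge>0. integral {0..t} (\<lambda>s. (p s)\<^sup>2) \<le> K"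
    using set_borel_integral_eq_integral(1)[OF p2_int]
    by (intro exI[of _ "integral {0..} (\<lambda>s. (p s)\<^sup>2)"] allI impI integral_subset_le
        integrable_on_atLeastAtMost_if_continuous_on_atLeast[of 0] continuous_intros p_cont) auto
  \<comment> \<open>Subtracting the integral equation of \<open>y\<close> from that of x' cancels
    the integral of \<open>f\<close>. The integrand that remains is continuous, so x' - y is
    differentiable even where x' is not.\<close>
  have z_eq: "x' t - y t = - integral {0..t} (\<lambda>s. p s * x' s + \<omega>\<^sup>2 * x s - \<omega>\<^sup>2 * y s)"
    if t: "t \<ge> 0" for t
  proof -
    have si: "set_integrable lborel {0..t} g" if "continuous_on {0..} g" for g :: "real \<Rightarrow> real"
      by (intro borel_integrable_atLeastAtMost' continuous_on_subset[OF that]) auto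
    note c = continuous_intros p_cont x'_cont x_cont y_cont
    have "x' t = (LINT s:{0..t}|lborel. f s - (p s * x' s + \<omega>\<^sup>2 * x s))"
      using x_ode[OF t] x'0 by (simp add: diff_diff_eq)
    also have "\<dots> = (LINT s:{0..t}|lborel. f s) - (LINT s:{0..t}|lborel. p s * x' s + \<omega>\<^sup>2 * x s)"
      by (intro set_integral_diff f_loc t si c)
    also have "(LINT s:{0..t}|lborel. f s) = y t + (LINT s:{0..t}|lborel. \<omega>\<^sup>2 * y s)"
      using y1_fun_integral_equation[OF f_loc[OF t] t, of \<omega>] by (simp add: y_def)
    finally have "x' t - y t =
      - ((LINT s:{0..t}|lborel. p s * x' s + \<omega>\<^sup>2 * x s) - (LINT s:{0..t}|lborel. \<omega>\<^sup>2 * y s))"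
      by simp
    also have "\<dots> = - (LINT s:{0..t}|lborel. p s * x' s + \<omega>\<^sup>2 * x s - \<omega>\<^sup>2 * y s)"
      by (subst set_integral_diff) (intro si c refl)+
    finally show ?thesis
      by (subst (asm) LINT_eq_integral_continuous) (intro c)
  qed
  have z_deriv: "((\<lambda>t. x' t - y t) has_real_derivative
      - \<omega>\<^sup>2 * x t - p t * (x' t - y t) + (\<omega>\<^sup>2 - p t) * y t) (at t within {0..})" if t: "t \<ge> 0" for t
  proof (rule has_field_derivative_transform_within[OF _ zero_less_one])
    have "((\<lambda>t. - integral {0..t} (\<lambda>s. p s * x' s + \<omega>\<^sup>2 * x s - \<omega>\<^sup>2 * y s)) has_real_derivative
        - (p t * x' t + \<omega>\<^sup>2 * x t - \<omega>\<^sup>2 * y t)) (at t within {0..})"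
      by (intro DERIV_minus integral_has_real_derivative_atLeast continuous_intros
          p_cont x'_cont x_cont y_cont t)
    then show "((\<lambda>t. - integral {0..t} (\<lambda>s. p s * x' s + \<omega>\<^sup>2 * x s - \<omega>\<^sup>2 * y s)) has_real_derivative
        - \<omega>\<^sup>2 * x t - p t * (x' t - y t) + (\<omega>\<^sup>2 - p t) * y t) (at t within {0..})"
      by (simp add: algebra_simps)
  qed (use t z_eq in auto)
  interpret damped_oscillator \<omega> p p' "damp_A p" y x "\<lambda>t. x' t - y t"
  proof (rule damped_oscillator.intro)
    show "\<And>t. t \<ge> 0 \<Longrightarrow> (x has_real_derivative x' t - y t + y t) (at t within {0..})"
      using x_deriv by simp
    show "x' 0 - y 0 = 0" using z_eq[of 0] by simp
  qed (fact omega_pos p_deriv p'_cont p_pos p'_neg p2_bounded A_deriv A_0 A_pos A_lim y_cont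
      z_deriv x0)+
  have J_integrable: "(\<lambda>s. damp_A p s * y s * E s) integrable_on {0..t}" for t
    by (intro integrable_on_atLeastAtMost_if_continuous_on_atLeast[of 0] continuous_intros conts E_cont) auto
  \<comment> \<open>\<open>E s\<close> is cos(omega s) - i sin(omega s), so the two integrals of (C)
    are Re J and -Im J. The sign is immaterial for o(A).\<close>
  have Re_J: "(LINT s:{0..t}|lborel. cos (\<omega> * s) * damp_A p s * y s) = Re (J t)" for t
    using integral_linear[OF J_integrable bounded_linear_Re, of t]
    by (subst LINT_eq_integral_continuous)
      (auto simp: J_def E_def o_def mult_ac intro!: continuous_intros conts)
  have "Im (J t) = integral {0..t} (\<lambda>s. - (sin (\<omega> * s) * damp_A p s * y s))" for t
    using integral_linear[OF J_integrable bounded_linear_Im, of t]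
    by (simp add: J_def E_def o_def mult_ac)
  then have Im_J: "(LINT s:{0..t}|lborel. sin (\<omega> * s) * damp_A p s * y s) = - Im (J t)" for t
    by (subst LINT_eq_integral_continuous) (auto intro!: continuous_intros conts)
  \<comment> \<open>In the forward direction \<open>y\<close> tends to 0 by assumption; backwards
    this is first recovered from \<open>x\<close> and x'. In both cases \<open>J_smallo_iff\<close>
    then applies, and z = x' - y translates between \<open>z\<close> and x'.\<close>
  have "(y \<longlongrightarrow> 0) at_top \<and> (\<lambda>t. norm (J t)) \<in> o[at_top](damp_A p)
      \<longleftrightarrow> (x \<longlongrightarrow> 0) at_top \<and> (x' \<longlongrightarrow> 0) at_top"
  proof (intro iffI; elim conjE)
    assume y: "(y \<longlongrightarrow> 0) at_top" and "(\<lambda>t. norm (J t)) \<in> o[at_top](damp_A p)"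
    then have "(x \<longlongrightarrow> 0) at_top" "((\<lambda>t. x' t - y t) \<longlongrightarrow> 0) at_top"
      using J_smallo_iff by auto
    with tendsto_add[OF this(2) y] show "(x \<longlongrightarrow> 0) at_top \<and> (x' \<longlongrightarrow> 0) at_top" by simp
  next
    assume x: "(x \<longlongrightarrow> 0) at_top" "(x' \<longlongrightarrow> 0) at_top"
    then have y: "(y \<longlongrightarrow> 0) at_top" by (intro y_tendsto_0) auto
    moreover from x y tendsto_diff[OF x(2) y] have "(\<lambda>t. norm (J t)) \<in> o[at_top](damp_A p)"
      using J_smallo_iff by simp
    ultimately show "(y \<longlongrightarrow> 0) at_top \<and> (\<lambda>t. norm (J t)) \<in> o[at_top](damp_A p)" by simp
  qed
  then show ?thesis
    unfolding norm_complex_smallo_iff y_def[symmetric] Re_J Im_J by simp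
qed

end
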